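(* Let $p$ be an odd prime, $r,q\ge1$ integers, $\varepsilon=p^r$. Let $\psi(a,b)=\chi(1+\varepsilon ab)$, a normalized $2$-cochain on the additive group $R_q$, and let $$\mathfrak A(a,b,c)=\frac{\psi(a,b)\,\psi(a+b,c)}{\psi(a,b+c)\,\psi(b,c)},\qquad a,b,c\in R_q.$$ Then $$\mathfrak A(a,b,c)=1\iff p^r abc(a-c)\equiv 0\pmod{p^q},$$ and consequently $\psi$ is a $2$-cocycle on $R_q$ if and only if $q\le r$. Moreover, when $q>r$: no normalized $1$-cochain repairs the failure, i.e. for every $f:R_q\to\mathbf C^\times$ with $f(0)=1$ the product $\psi\cdot\delta f$ is not a $2$-cocycle; and no automorphism of the cyclic group $R_q$ removes it, i.e. for every $u\in R_q^\times$ the cochain $(a,b)\mapsto\psi(ua,ub)$ is not a $2$-cocycle.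
   Context: $\mathbf Z_p$ is the ring of $p$-adic integers, $R_q=\mathbf Z/p^q\mathbf Z$. $\chi$ is a fixed faithful (injective) character of the cyclic group $(1+p^r\mathbf Z_p)/(1+p^{q+r}\mathbf Z_p)$ of order $p^q$, with values in complex roots of unity; $\chi(1+\varepsilon ab)$ is independent of lifts of $a,b\in R_q$ to $\mathbf Z_p$. A function $\psi:R_q\times R_q\to\mathbf C^\times$ is a normalized $2$-cochain if $\psi(a,0)=\psi(0,a)=1$ for all $a$; it is a $2$-cocycle (trivial action) if $\psi(a,b)\psi(a+b,c)=\psi(a,b+c)\psi(b,c)$ for all $a,b,c\in R_q$. For a $1$-cochain $f$, its coboundary is $\delta f(a,b)=f(a)f(b)/f(a+b)$. *)

theory Defs
  imports Complex_Main "HOL-Algebra.Coset" "HOL-Number_Theory.Residues"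
    "HOL-Number_Theory.Modular_Inverse"
begin

section \<open>The p-adic integers and the principal unit groups\<close>

text \<open>
  The ring of p-adic integers is the inverse limit of the rings of integers modulo
  \<open>p ^ n\<close>: an element is a coherent sequence of residues, represented
  canonically in \<open>{0..<p ^ n}\<close>.  The residue \<open>1 mod p ^ n\<close> in the unit element is
  \<open>0\<close> for \<open>n = 0\<close>.
\<close>

definition padic_int :: "int \<Rightarrow> (nat \<Rightarrow> int) ring" where
  "padic_int p =
     \<lparr>carrier = {x. \<forall>n. x n \<in> {0..<p ^ n} \<and> x (Suc n) mod p ^ n = x n},
      monoid.mult = (\<lambda>x y n. (x n * y n) mod p ^ n),
      one = (\<lambda>n. 1 mod p ^ n),
      ring.zero = (\<lambda>n. 0),
      ring.add = (\<lambda>x y n. (x n + y n) mod p ^ n)\<rparr>"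

definition padic_of_int :: "int \<Rightarrow> int \<Rightarrow> nat \<Rightarrow> int" where
  "padic_of_int p k = (\<lambda>n. k mod p ^ n)"

definition principal_units :: "int \<Rightarrow> nat \<Rightarrow> (nat \<Rightarrow> int) set" where
  "principal_units p k =
     {\<one>\<^bsub>padic_int p\<^esub> \<oplus>\<^bsub>padic_int p\<^esub> padic_of_int p (p ^ k) \<otimes>\<^bsub>padic_int p\<^esub> z | z.
        z \<in> carrier (padic_int p)}"

definition principal_unit_group :: "int \<Rightarrow> nat \<Rightarrow> (nat \<Rightarrow> int) monoid" where
  "principal_unit_group p k = (units_of (padic_int p))\<lparr>carrier := principal_units p k\<rparr>"

text \<open>The cyclic group $(1 + p^r \mathbf{Z}_p) / (1 + p^{q+r} \mathbf{Z}_p)$.\<close>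

definition principal_unit_quotient :: "int \<Rightarrow> nat \<Rightarrow> nat \<Rightarrow> (nat \<Rightarrow> int) set monoid" where
  "principal_unit_quotient p r q = principal_unit_group p r Mod principal_units p (q + r)"


section \<open>Characters and cochains\<close>

definition complex_units :: "complex monoid" where
  "complex_units = \<lparr>carrier = UNIV - {0}, monoid.mult = (*), one = 1\<rparr>"

definition faithful_character :: "('a, 'b) monoid_scheme \<Rightarrow> ('a \<Rightarrow> complex) \<Rightarrow> bool" where
  "faithful_character G \<chi> \<longleftrightarrow>
     \<chi> \<in> hom G complex_units \<and> inj_on \<chi> (carrier G) \<and>
     (\<forall>g \<in> carrier G. \<exists>n>0. \<chi> g ^ n = 1)"

text \<open>
  Cochains are taken on the additive group of a ring \<open>R\<close>, with trivial action on
  the nonzero complex numbers; only their values on \<open>carrier R\<close> matter.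
\<close>

definition normalized_2cochain :: "('a, 'b) ring_scheme \<Rightarrow> ('a \<Rightarrow> 'a \<Rightarrow> complex) \<Rightarrow> bool" where
  "normalized_2cochain R \<psi> \<longleftrightarrow>
     (\<forall>a \<in> carrier R. \<forall>b \<in> carrier R. \<psi> a b \<in> carrier complex_units) \<and>
     (\<forall>a \<in> carrier R. \<psi> a \<zero>\<^bsub>R\<^esub> = 1 \<and> \<psi> \<zero>\<^bsub>R\<^esub> a = 1)"

definition is_2cocycle :: "('a, 'b) ring_scheme \<Rightarrow> ('a \<Rightarrow> 'a \<Rightarrow> complex) \<Rightarrow> bool" where
  "is_2cocycle R \<psi> \<longleftrightarrow>
     (\<forall>a \<in> carrier R. \<forall>b \<in> carrier R. \<forall>c \<in> carrier R.
        \<psi> a b * \<psi> (a \<oplus>\<^bsub>R\<^esub> b) c = \<psi> a (b \<oplus>\<^bsub>R\<^esub> c) * \<psi> b c)"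

definition associator ::
  "('a, 'b) ring_scheme \<Rightarrow> ('a \<Rightarrow> 'a \<Rightarrow> complex) \<Rightarrow> 'a \<Rightarrow> 'a \<Rightarrow> 'a \<Rightarrow> complex" where
  "associator R \<psi> a b c =
     (\<psi> a b * \<psi> (a \<oplus>\<^bsub>R\<^esub> b) c) / (\<psi> a (b \<oplus>\<^bsub>R\<^esub> c) * \<psi> b c)"

definition normalized_1cochain :: "('a, 'b) ring_scheme \<Rightarrow> ('a \<Rightarrow> complex) \<Rightarrow> bool" where
  "normalized_1cochain R f \<longleftrightarrow> f \<in> carrier R \<rightarrow> carrier complex_units \<and> f \<zero>\<^bsub>R\<^esub> = 1"

definition coboundary :: "('a, 'b) ring_scheme \<Rightarrow> ('a \<Rightarrow> complex) \<Rightarrow> 'a \<Rightarrow> 'a \<Rightarrow> complex" where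
  "coboundary R f a b = f a * f b / f (a \<oplus>\<^bsub>R\<^esub> b)"


section \<open>The cochain attached to a character\<close>

definition unit_coset ::
  "int \<Rightarrow> nat \<Rightarrow> nat \<Rightarrow> (nat \<Rightarrow> int) \<Rightarrow> (nat \<Rightarrow> int) \<Rightarrow> (nat \<Rightarrow> int) set" where
  "unit_coset p r q x y =
     principal_units p (q + r) #>\<^bsub>principal_unit_group p r\<^esub>
       (\<one>\<^bsub>padic_int p\<^esub> \<oplus>\<^bsub>padic_int p\<^esub>
          padic_of_int p (p ^ r) \<otimes>\<^bsub>padic_int p\<^esub> (x \<otimes>\<^bsub>padic_int p\<^esub> y))"

text \<open>
  Elements of \<open>residue_ring (p ^ q)\<close> are integers in \<open>{0..p ^ q - 1}\<close>, and
  these integers serve as the p-adic lifts.  Lemma \<open>psi_eq_lifts\<close> below shows that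
  any other lifts give the same value.
\<close>

definition psi ::
  "int \<Rightarrow> nat \<Rightarrow> nat \<Rightarrow> ((nat \<Rightarrow> int) set \<Rightarrow> complex) \<Rightarrow> int \<Rightarrow> int \<Rightarrow> complex" where
  "psi p r q \<chi> a b = \<chi> (unit_coset p r q (padic_of_int p a) (padic_of_int p b))"

subsection \<open>Independence of the lifts\<close>

lemma padic_int_simps:
  "x \<otimes>\<^bsub>padic_int p\<^esub> y = (\<lambda>n. (x n * y n) mod p ^ n)"
  "x \<oplus>\<^bsub>padic_int p\<^esub> y = (\<lambda>n. (x n + y n) mod p ^ n)"
  "\<one>\<^bsub>padic_int p\<^esub> = (\<lambda>n. 1 mod p ^ n)"
  "\<zero>\<^bsub>padic_int p\<^esub> = (\<lambda>n. 0)"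
  by (simp_all add: padic_int_def)

lemma carrier_padic_int:
  assumes "p > 0"
  shows "x \<in> carrier (padic_int p) \<longleftrightarrow>
    (\<forall>n. x n mod p ^ n = x n) \<and> (\<forall>n. x (Suc n) mod p ^ n = x n)"
proof -
  have "x n \<in> {0..<p ^ n} \<longleftrightarrow> x n mod p ^ n = x n" for n
    by (metis assms atLeastLessThan_iff mod_pos_pos_trivial pos_mod_bound pos_mod_sign zero_less_power)
  then show ?thesis
    by (auto simp: padic_int_def)
qed

lemma mod_Suc_power:
  "(a mod (p ^ n * p)) mod p ^ n = a mod (p :: int) ^ n"
  "(a mod (p * p ^ n)) mod p ^ n = a mod (p :: int) ^ n"
  by (rule mod_mod_cancel, simp)+

lemma mod_affine: "(y + a * (b mod m)) mod m = (y + a * b) mod (m :: int)"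
  by (metis mod_add_right_eq mod_mult_right_eq)

lemma padic_of_int_carrier: "p > 0 \<Longrightarrow> padic_of_int p k \<in> carrier (padic_int p)"
  unfolding carrier_padic_int padic_of_int_def by (simp add: mod_Suc_power)

lemma padic_mult_closed:
  assumes "p > 0" "x \<in> carrier (padic_int p)" "y \<in> carrier (padic_int p)"
  shows "x \<otimes>\<^bsub>padic_int p\<^esub> y \<in> carrier (padic_int p)"
proof -
  have "(x (Suc n) * y (Suc n)) mod p ^ n = (x n * y n) mod p ^ n" for n
    using assms by (metis carrier_padic_int mod_mult_eq)
  then show ?thesis
    by (simp add: carrier_padic_int[OF assms(1)] padic_int_simps mod_Suc_power)
qed

lemma padic_add_closed:
  assumes "p > 0" "x \<in> carrier (padic_int p)" "y \<in> carrier (padic_int p)"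
  shows "x \<oplus>\<^bsub>padic_int p\<^esub> y \<in> carrier (padic_int p)"
proof -
  have "(x (Suc n) + y (Suc n)) mod p ^ n = (x n + y n) mod p ^ n" for n
    using assms by (metis carrier_padic_int mod_add_eq)
  then show ?thesis
    by (simp add: carrier_padic_int[OF assms(1)] padic_int_simps mod_Suc_power)
qed

lemma padic_one_closed: "p > 0 \<Longrightarrow> \<one>\<^bsub>padic_int p\<^esub> \<in> carrier (padic_int p)"
  using padic_of_int_carrier[of p 1] by (simp add: padic_of_int_def padic_int_simps)

lemma padic_minus_closed:
  assumes "p > 0" "x \<in> carrier (padic_int p)"
  shows "(\<lambda>n. (- x n) mod p ^ n) \<in> carrier (padic_int p)"
proof -
  have "(- x (Suc n)) mod p ^ n = (- x n) mod p ^ n" for n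
    using assms by (metis carrier_padic_int mod_minus_eq)
  then show ?thesis
    by (simp add: carrier_padic_int[OF assms(1)] mod_Suc_power)
qed

lemma padic_cring:
  assumes "p > 0"
  shows "cring (padic_int p)"
proof (rule cringI)
  show "abelian_group (padic_int p)"
  proof (rule abelian_groupI)
    fix x assume x: "x \<in> carrier (padic_int p)"
    show "\<exists>y\<in>carrier (padic_int p). y \<oplus>\<^bsub>padic_int p\<^esub> x = \<zero>\<^bsub>padic_int p\<^esub>"
      by (rule bexI[OF _ padic_minus_closed[OF assms x]])
        (simp add: padic_int_simps mod_add_left_eq)
  qed (use assms in \<open>auto simp: padic_add_closed\<close>,
      auto simp: carrier_padic_int padic_int_simps algebra_simps mod_simps)
  show "comm_monoid (padic_int p)"
    by (rule comm_monoidI)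
      (use assms in \<open>auto simp: padic_mult_closed padic_one_closed\<close>,
       auto simp: carrier_padic_int padic_int_simps algebra_simps mod_simps)
  fix x y z
  show "(x \<oplus>\<^bsub>padic_int p\<^esub> y) \<otimes>\<^bsub>padic_int p\<^esub> z =
        x \<otimes>\<^bsub>padic_int p\<^esub> z \<oplus>\<^bsub>padic_int p\<^esub> y \<otimes>\<^bsub>padic_int p\<^esub> z"
    by (simp add: padic_int_simps algebra_simps mod_simps)
qed

lemma principal_units_subset: "p > 0 \<Longrightarrow> principal_units p k \<subseteq> carrier (padic_int p)"
  by (auto simp: principal_units_def padic_add_closed padic_mult_closed padic_one_closed
      padic_of_int_carrier)

lemma principal_units_iff:
  "u \<in> principal_units p k \<longleftrightarrow>
    (\<exists>z \<in> carrier (padic_int p). \<forall>n. u n = (1 + p ^ k * z n) mod p ^ n)"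
  by (auto simp: principal_units_def padic_of_int_def padic_int_simps mod_simps fun_eq_iff)

lemma principal_units_mono:
  assumes "p > 0" "j \<le> k"
  shows "principal_units p k \<subseteq> principal_units p j"
proof
  fix u assume "u \<in> principal_units p k"
  then obtain z where z: "z \<in> carrier (padic_int p)" "\<And>n. u n = (1 + p ^ k * z n) mod p ^ n"
    by (auto simp: principal_units_iff)
  have "(p :: int) ^ k = p ^ j * p ^ (k - j)"
    using assms(2) by (simp flip: power_add)
  then have "u n = (1 + p ^ j * ((padic_of_int p (p ^ (k - j)) \<otimes>\<^bsub>padic_int p\<^esub> z) n)) mod p ^ n" for n
    by (simp add: z(2) padic_of_int_def padic_int_simps mod_affine mod_mult_left_eq mult.assoc)
  then show "u \<in> principal_units p j"
    using padic_mult_closed[OF assms(1) padic_of_int_carrier[OF assms(1)] z(1)]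
    by (auto simp: principal_units_iff)
qed

lemma principal_units_one: "p > 0 \<Longrightarrow> \<one>\<^bsub>padic_int p\<^esub> \<in> principal_units p k"
  unfolding principal_units_iff padic_int_simps
  by (rule bexI[OF _ padic_of_int_carrier[of p 0]]) (simp_all add: padic_of_int_def)

lemma principal_units_mult:
  assumes "p > 0" "u \<in> principal_units p k" "v \<in> principal_units p k"
  shows "u \<otimes>\<^bsub>padic_int p\<^esub> v \<in> principal_units p k"
proof -
  interpret cring "padic_int p" by (rule padic_cring[OF assms(1)])
  obtain z where z: "z \<in> carrier (padic_int p)" "\<And>n. u n = (1 + p ^ k * z n) mod p ^ n"
    using assms(2) by (auto simp: principal_units_iff)
  obtain w where w: "w \<in> carrier (padic_int p)" "\<And>n. v n = (1 + p ^ k * w n) mod p ^ n"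
    using assms(3) by (auto simp: principal_units_iff)
  let ?y = "z \<oplus>\<^bsub>padic_int p\<^esub> (w \<otimes>\<^bsub>padic_int p\<^esub> u)"
  have u: "u \<in> carrier (padic_int p)"
    using principal_units_subset assms(1,2) by blast
  have "(u \<otimes>\<^bsub>padic_int p\<^esub> v) n = (1 + p ^ k * ?y n) mod p ^ n" for n
  proof -
    have "(u \<otimes>\<^bsub>padic_int p\<^esub> v) n = ((1 + p ^ k * z n) * (1 + p ^ k * w n)) mod p ^ n"
      by (simp add: padic_int_simps z(2) w(2) mod_mult_eq)
    also have "\<dots> = (1 + p ^ k * (z n + w n * (1 + p ^ k * z n))) mod p ^ n"
      by (simp add: algebra_simps)
    also have "\<dots> = (1 + p ^ k * ((z n + (w n * ((1 + p ^ k * z n) mod p ^ n)) mod p ^ n) mod p ^ n)) mod p ^ n"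
      by (simp only: mod_affine mod_add_right_eq mod_mult_right_eq)
    finally show ?thesis
      unfolding padic_int_simps z(2) .
  qed
  moreover have "?y \<in> carrier (padic_int p)"
    using z w u by simp
  ultimately show ?thesis
    unfolding principal_units_iff by blast
qed

lemma principal_units_inverse:
  assumes "p > 1" "k \<ge> 1" "u \<in> principal_units p k"
  obtains v where "v \<in> principal_units p k" "v \<otimes>\<^bsub>padic_int p\<^esub> u = \<one>\<^bsub>padic_int p\<^esub>"
proof -
  have p: "p > 0" using assms(1) by simp
  obtain z where z: "z \<in> carrier (padic_int p)" "\<And>n. u n = (1 + p ^ k * z n) mod p ^ n"
    using assms(3) by (auto simp: principal_units_iff)
  have u: "u \<in> carrier (padic_int p)"
    using principal_units_subset[OF p] assms(3) by blast
  define v where "v = (\<lambda>n. modular_inverse (p ^ n) (u n))"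
  have cop: "coprime (u n) (p ^ n)" for n
  proof -
    have "coprime (1 + p ^ k * z n) p"
    proof (rule coprimeI)
      fix c assume "c dvd 1 + p ^ k * z n" "c dvd p"
      moreover from this have "c dvd p ^ k * z n"
        using assms(2) by (metis One_nat_def Suc_le_D dvd_mult2 power_Suc)
      ultimately show "is_unit c"
        by (metis dvd_add_left_iff)
    qed
    then have "coprime (1 + p ^ k * z n) (p ^ n)" by simp
    moreover have "p ^ n \<noteq> 0" using p by simp
    ultimately show ?thesis
      unfolding z(2) by (metis coprime_iff_gcd_eq_1 gcd_mod_left)
  qed
  have vu: "[v n * u n = 1] (mod p ^ n)" for n
    unfolding v_def by (rule cong_modular_inverse2[OF cop])
  have range: "v n \<in> {0..<p ^ n}" for n
    using p by (simp add: v_def modular_inverse_int_nonneg modular_inverse_int_less)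
  have "v (Suc n) mod p ^ n = v n" for n
  proof -
    have "[v (Suc n) * u (Suc n) = 1] (mod p ^ n)"
      by (rule cong_dvd_modulus[OF vu[of "Suc n"]]) simp
    moreover have "[u (Suc n) = u n] (mod p ^ n)"
      using u p by (simp add: carrier_padic_int cong_def)
    ultimately have "[u n * (v (Suc n) mod p ^ n) = 1] (mod p ^ n)"
      by (metis cong_def mod_mult_eq mod_mod_trivial mult.commute)
    then show ?thesis
      unfolding v_def using p by (intro modular_inverse_int_eqI[symmetric]) auto
  qed
  then have v: "v \<in> carrier (padic_int p)"
    using range by (auto simp: padic_int_def)
  show thesis
  proof
    show "v \<otimes>\<^bsub>padic_int p\<^esub> u = \<one>\<^bsub>padic_int p\<^esub>"
      using vu by (simp add: padic_int_simps cong_def)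
    define w where "w = (\<lambda>n. (- (z \<otimes>\<^bsub>padic_int p\<^esub> v) n) mod p ^ n)"
    have "w \<in> carrier (padic_int p)"
      unfolding w_def by (intro padic_minus_closed padic_mult_closed p z v)
    moreover have "v n = (1 + p ^ k * w n) mod p ^ n" for n
    proof -
      have "[v n * (1 + p ^ k * z n) = 1] (mod p ^ n)"
        using vu[of n] by (simp add: z(2) cong_def mod_simps)
      from cong_diff[OF this cong_refl[of "p ^ k * (z n * v n)"]]
      have "[v n = 1 - p ^ k * (z n * v n)] (mod p ^ n)"
        by (simp add: algebra_simps)
      moreover have "(1 + p ^ k * w n) mod p ^ n = (1 - p ^ k * (z n * v n)) mod p ^ n"
        using mod_affine[of 1 "p ^ k" "- (z n * v n)" "p ^ n"]
        by (simp add: w_def padic_int_simps mod_minus_eq)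
      ultimately show ?thesis
        using range[of n] by (simp add: cong_def)
    qed
    ultimately show "v \<in> principal_units p k"
      by (auto simp: principal_units_iff)
  qed
qed

lemma principal_unit_group_simps:
  "carrier (principal_unit_group p k) = principal_units p k"
  "x \<otimes>\<^bsub>principal_unit_group p k\<^esub> y = x \<otimes>\<^bsub>padic_int p\<^esub> y"
  "\<one>\<^bsub>principal_unit_group p k\<^esub> = \<one>\<^bsub>padic_int p\<^esub>"
  by (simp_all add: principal_unit_group_def units_of_def)

lemma comm_group_principal_unit_group:
  assumes "p > 1" "k \<ge> 1"
  shows "comm_group (principal_unit_group p k)"
proof -
  have p: "p > 0" using assms(1) by simp
  interpret cring "padic_int p" by (rule padic_cring[OF p])
  have carr: "x \<in> carrier (padic_int p)" if "x \<in> principal_units p k" for x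
    using that principal_units_subset[OF p] by blast
  show ?thesis
  proof (rule comm_groupI, goal_cases)
    case (6 x)
    then show ?case
      using principal_units_inverse[OF assms, of x] by (auto simp: principal_unit_group_simps)
  qed (auto simp: principal_unit_group_simps principal_units_mult principal_units_one p carr
        m_assoc m_lcomm m_comm)
qed

lemma principal_units_subgroup:
  assumes "p > 1" "k \<ge> 1" "k \<le> j"
  shows "subgroup (principal_units p j) (principal_unit_group p k)"
proof -
  have p: "p > 0" using assms(1) by simp
  interpret G: comm_group "principal_unit_group p k"
    by (rule comm_group_principal_unit_group[OF assms(1,2)])
  show ?thesis
  proof (rule G.subgroupI)
    show "principal_units p j \<subseteq> carrier (principal_unit_group p k)"
      using principal_units_mono[OF p assms(3)] by (simp add: principal_unit_group_simps)
    show "principal_units p j \<noteq> {}"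
      using principal_units_one[OF p] by blast
    fix a assume a: "a \<in> principal_units p j"
    from assms have "j \<ge> 1" by simp
    then obtain v where v: "v \<in> principal_units p j" "v \<otimes>\<^bsub>padic_int p\<^esub> a = \<one>\<^bsub>padic_int p\<^esub>"
      using principal_units_inverse[OF assms(1) _ a] by blast
    have "inv\<^bsub>principal_unit_group p k\<^esub> a = v"
      using v(2) subsetD[OF principal_units_mono[OF p assms(3)] a]
        subsetD[OF principal_units_mono[OF p assms(3)] v(1)]
      by (intro G.inv_equality) (simp_all add: principal_unit_group_simps)
    with v show "inv\<^bsub>principal_unit_group p k\<^esub> a \<in> principal_units p j" by simp
  next
    fix a b assume "a \<in> principal_units p j" "b \<in> principal_units p j"
    then show "a \<otimes>\<^bsub>principal_unit_group p k\<^esub> b \<in> principal_units p j"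
      by (simp add: principal_unit_group_simps principal_units_mult[OF p])
  qed
qed

text \<open>Congruence of p-adic integers modulo \<open>p ^ q\<close> is equality of the \<open>q\<close>-th residues.\<close>

lemma padic_cong_imp_multiple:
  assumes "p > 0" "x \<in> carrier (padic_int p)" "y \<in> carrier (padic_int p)" "x q = y q"
  obtains z where "z \<in> carrier (padic_int p)"
    "x = y \<oplus>\<^bsub>padic_int p\<^esub> padic_of_int p (p ^ q) \<otimes>\<^bsub>padic_int p\<^esub> z"
proof -
  define d where "d = (\<lambda>n. x (n + q) - y (n + q))"
  have stable: "x (n + q) mod p ^ n = x n" if "x \<in> carrier (padic_int p)" for x n q
  proof (induction q)
    case 0
    have "x n mod p ^ n = x n"
      using that assms(1) by (simp add: carrier_padic_int)
    then show ?case by simp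
  next
    case (Suc q)
    have "x (Suc (n + q)) mod p ^ (n + q) = x (n + q)"
      using that assms(1) by (simp add: carrier_padic_int)
    moreover have "(x (Suc (n + q)) mod p ^ (n + q)) mod p ^ n = x (Suc (n + q)) mod p ^ n"
      by (rule mod_mod_cancel) (simp add: power_add)
    ultimately show ?case using Suc.IH by simp
  qed
  have dvd: "p ^ q dvd d n" for n
  proof -
    have "x (q + n) mod p ^ q = y (q + n) mod p ^ q"
      unfolding stable[OF assms(2)] stable[OF assms(3)] by (rule assms(4))
    then show ?thesis
      unfolding mod_eq_dvd_iff d_def by (simp only: add.commute)
  qed
  define e where "e n = d n div p ^ q" for n
  have e: "d n = p ^ q * e n" for n
    using dvd by (simp add: e_def)
  define z where "z n = e n mod p ^ n" for n
  have "e (Suc n) mod p ^ n = e n mod p ^ n" for n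
  proof -
    have "p ^ (n + q) dvd d (Suc n) - d n"
    proof -
      have "[x (Suc (n + q)) = x (n + q)] (mod p ^ (n + q))"
        "[y (Suc (n + q)) = y (n + q)] (mod p ^ (n + q))"
        using assms by (simp_all add: carrier_padic_int cong_def)
      from cong_diff[OF this] show ?thesis
        by (simp add: d_def cong_iff_dvd_diff)
    qed
    then have "p ^ q * p ^ n dvd p ^ q * (e (Suc n) - e n)"
      by (simp add: e power_add algebra_simps)
    then show ?thesis
      using assms(1) by (simp add: mod_eq_dvd_iff)
  qed
  then have z: "z \<in> carrier (padic_int p)"
    by (simp add: carrier_padic_int[OF assms(1)] z_def mod_Suc_power)
  moreover have "x = y \<oplus>\<^bsub>padic_int p\<^esub> padic_of_int p (p ^ q) \<otimes>\<^bsub>padic_int p\<^esub> z"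
  proof
    fix n
    have "x n = (y (n + q) + d n) mod p ^ n"
      using stable[OF assms(2), of n q] by (simp add: d_def)
    also have "\<dots> = (y (n + q) mod p ^ n + p ^ q * (e n mod p ^ n)) mod p ^ n"
      by (simp only: e mod_affine mod_add_left_eq)
    also have "\<dots> = (y n + p ^ q * z n) mod p ^ n"
      by (simp add: stable[OF assms(3)] z_def)
    finally show "x n = (y \<oplus>\<^bsub>padic_int p\<^esub> padic_of_int p (p ^ q) \<otimes>\<^bsub>padic_int p\<^esub> z) n"
      by (simp add: padic_int_simps padic_of_int_def mod_simps)
  qed
  ultimately show thesis using that by blast
qed

lemma (in cring) unit_multiple:
  assumes c: "e \<in> carrier R" "f \<in> carrier R" "t \<in> carrier R" "z \<in> carrier R" "v \<in> carrier R"
    and inv: "v \<otimes> (\<one> \<oplus> e \<otimes> t) = \<one>"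
  shows "(\<one> \<oplus> (e \<otimes> f) \<otimes> (z \<otimes> v)) \<otimes> (\<one> \<oplus> e \<otimes> t) = \<one> \<oplus> e \<otimes> (t \<oplus> f \<otimes> z)"
proof -
  define u where "u = \<one> \<oplus> e \<otimes> t"
  have u: "u \<in> carrier R" using c by (simp add: u_def)
  have vu: "v \<otimes> u = \<one>" using inv by (simp add: u_def)
  have "(\<one> \<oplus> (e \<otimes> f) \<otimes> (z \<otimes> v)) \<otimes> u = u \<oplus> (e \<otimes> f) \<otimes> (z \<otimes> (v \<otimes> u))"
    using c u by (simp add: l_distr m_assoc)
  also have "\<dots> = \<one> \<oplus> e \<otimes> (t \<oplus> f \<otimes> z)"
    using c unfolding vu by (simp add: u_def r_distr m_assoc a_assoc)
  finally show ?thesis by (simp add: u_def)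
qed

lemma unit_coset_cong:
  assumes p: "p > 1" and r: "r \<ge> 1"
    and x: "x \<in> carrier (padic_int p)" "x' \<in> carrier (padic_int p)" "x q = x' q"
    and y: "y \<in> carrier (padic_int p)" "y' \<in> carrier (padic_int p)" "y q = y' q"
  shows "unit_coset p r q x y = unit_coset p r q x' y'"
proof -
  have p0: "p > 0" using p by simp
  interpret cring "padic_int p" by (rule padic_cring[OF p0])
  interpret G: comm_group "principal_unit_group p r"
    by (rule comm_group_principal_unit_group[OF p r])
  let ?U = "\<lambda>x y. \<one>\<^bsub>padic_int p\<^esub> \<oplus>\<^bsub>padic_int p\<^esub>
    padic_of_int p (p ^ r) \<otimes>\<^bsub>padic_int p\<^esub> (x \<otimes>\<^bsub>padic_int p\<^esub> y)"
  have mem: "?U x y \<in> principal_units p r"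
    if "x \<in> carrier (padic_int p)" "y \<in> carrier (padic_int p)" for x y
    unfolding principal_units_def using m_closed[OF that] by blast
  have "(x \<otimes>\<^bsub>padic_int p\<^esub> y) q = (x' \<otimes>\<^bsub>padic_int p\<^esub> y') q"
    using x y by (simp add: padic_int_simps)
  then obtain z where z: "z \<in> carrier (padic_int p)" "x \<otimes>\<^bsub>padic_int p\<^esub> y =
      x' \<otimes>\<^bsub>padic_int p\<^esub> y' \<oplus>\<^bsub>padic_int p\<^esub> padic_of_int p (p ^ q) \<otimes>\<^bsub>padic_int p\<^esub> z"
    using padic_cong_imp_multiple[OF p0, of "x \<otimes>\<^bsub>padic_int p\<^esub> y" "x' \<otimes>\<^bsub>padic_int p\<^esub> y'" q] m_closed[OF x(1) y(1)]
      m_closed[OF x(2) y(2)] by blast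
  obtain v where v: "v \<in> principal_units p r" "v \<otimes>\<^bsub>padic_int p\<^esub> ?U x' y' = \<one>\<^bsub>padic_int p\<^esub>"
    using principal_units_inverse[OF p r mem[OF x(2) y(2)]] .
  have vc: "v \<in> carrier (padic_int p)"
    using v(1) principal_units_subset[OF p0] by blast
  have pow: "padic_of_int p (p ^ (q + r)) =
      padic_of_int p (p ^ r) \<otimes>\<^bsub>padic_int p\<^esub> padic_of_int p (p ^ q)"
    by (simp add: padic_of_int_def padic_int_simps mod_mult_eq power_add mult.commute)
  note pc = padic_of_int_carrier[OF p0]
  let ?h = "\<one>\<^bsub>padic_int p\<^esub> \<oplus>\<^bsub>padic_int p\<^esub>
    padic_of_int p (p ^ (q + r)) \<otimes>\<^bsub>padic_int p\<^esub> (z \<otimes>\<^bsub>padic_int p\<^esub> v)"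
  have h: "?h \<in> principal_units p (q + r)"
    unfolding principal_units_def using m_closed[OF z(1) vc] by blast
  have "?h \<otimes>\<^bsub>padic_int p\<^esub> ?U x' y' = ?U x y"
    unfolding pow z(2)
    by (rule unit_multiple[OF pc pc m_closed[OF x(2) y(2)] z(1) vc v(2)])
  then have "?U x y \<in> principal_units p (q + r) #>\<^bsub>principal_unit_group p r\<^esub> ?U x' y'"
    unfolding r_coset_def principal_unit_group_simps by (intro UN_I[OF h]) simp
  then show ?thesis
    unfolding unit_coset_def
    by (rule G.repr_independence[symmetric, OF _ _ principal_units_subgroup[OF p r]])
      (simp_all add: principal_unit_group_simps mem[OF x(2) y(2)])
qed

lemma psi_eq_lifts:
  assumes "p > 1" "r \<ge> 1" "a \<in> carrier (residue_ring (p ^ q))" "b \<in> carrier (residue_ring (p ^ q))"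
    and "x \<in> carrier (padic_int p)" "x q = a" "y \<in> carrier (padic_int p)" "y q = b"
  shows "\<chi> (unit_coset p r q x y) = psi p r q \<chi> a b"
  unfolding psi_def using assms
  by (intro arg_cong[of _ _ \<chi>] unit_coset_cong)
    (auto simp: padic_of_int_carrier,
      auto simp: padic_of_int_def residue_ring_def)

end

theory Submission
  imports Defs
begin

text \<open>
  In $\mathbf{Z}_p$ the products \<open>(1 + \<epsilon>ab)(1 + \<epsilon>(a + b)c)\<close> and
  \<open>(1 + \<epsilon>a(b + c))(1 + \<epsilon>bc)\<close> differ by \<open>\<epsilon>\<^sup>2abc(a - c)\<close>.  As the character is faithful on
  units modulo \<open>p ^ (q + r)\<close>, the associator is trivial exactly when \<open>p ^ (2 * r) * a * b * c * (a - c)\<close>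
  vanishes modulo \<open>p ^ (q + r)\<close>.  At \<open>(1, 1, 2)\<close> this expression is \<open>-2 * p ^ (2 * r)\<close>, which is
  nonzero for odd \<open>p\<close> and \<open>q > r\<close>.  Coboundaries are cocycles, and multiplication by a unit
  permutes the arguments of the associator, so neither changes whether it is trivial everywhere.
\<close>

lemma padic_of_int_add:
  "padic_of_int p m \<oplus>\<^bsub>padic_int p\<^esub> padic_of_int p n = padic_of_int p (m + n)"
  by (simp add: padic_int_simps padic_of_int_def mod_add_eq)

lemma padic_of_int_mult:
  "padic_of_int p m \<otimes>\<^bsub>padic_int p\<^esub> padic_of_int p n = padic_of_int p (m * n)"
  by (simp add: padic_int_simps padic_of_int_def mod_mult_eq)

lemma padic_of_int_one: "\<one>\<^bsub>padic_int p\<^esub> = padic_of_int p 1"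
  by (simp add: padic_int_simps padic_of_int_def)

lemma unit_coset_of_int:
  "unit_coset p r q (padic_of_int p a) (padic_of_int p b) =
    principal_units p (q + r) #>\<^bsub>principal_unit_group p r\<^esub> padic_of_int p (1 + p ^ r * (a * b))"
  by (simp add: unit_coset_def padic_of_int_add padic_of_int_mult padic_of_int_one)

lemma padic_of_int_principal_unit:
  assumes "p > 0"
  shows "padic_of_int p (1 + p ^ r * t) \<in> principal_units p r"
  unfolding principal_units_def padic_of_int_one
  using padic_of_int_carrier[OF assms, of t]
  by (auto simp: padic_of_int_add[symmetric] padic_of_int_mult[symmetric])

text \<open>Lying in one coset of \<open>principal_units p (q + r)\<close> amounts to a congruence
  modulo \<open>p ^ (q + r)\<close> between units that both have the form
  \<open>1 + p ^ r * t\<close>. Cancelling \<open>p ^ r\<close> leaves a congruence modulo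
  \<open>p ^ q\<close>.\<close>

lemma unit_coset_of_int_eq_iff:
  assumes p: "p > 1" and r: "r \<ge> 1"
  shows "unit_coset p r q (padic_of_int p a) (padic_of_int p b) =
      unit_coset p r q (padic_of_int p c) (padic_of_int p d) \<longleftrightarrow>
    [a * b = c * d] (mod p ^ q)" (is "?L \<longleftrightarrow> ?R")
proof
  have p0: "p > 0" using p by simp
  show ?L if ?R
  proof -
    \<comment> \<open>\<open>unit_coset_cong\<close> compares the arguments one by one, but only the
      products are known to be congruent; since the coset depends on the product alone, it is moved
      into the first argument.\<close>
    have "unit_coset p r q (padic_of_int p (a * b)) (padic_of_int p 1) =
      unit_coset p r q (padic_of_int p (c * d)) (padic_of_int p 1)"
      by (intro unit_coset_cong[OF p r] padic_of_int_carrier[OF p0])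
        (use \<open>?R\<close> in \<open>simp_all add: padic_of_int_def cong_def\<close>)
    then show ?thesis by (simp add: unit_coset_of_int)
  qed
  show ?R if ?L
  proof -
    interpret G: comm_group "principal_unit_group p r"
      by (rule comm_group_principal_unit_group[OF p r])
    let ?u = "padic_of_int p (1 + p ^ r * (a * b))"
    let ?v = "padic_of_int p (1 + p ^ r * (c * d))"
    have "?u \<in> principal_units p (q + r) #>\<^bsub>principal_unit_group p r\<^esub> ?u"
      by (rule G.rcos_self[OF _ principal_units_subgroup[OF p r]])
        (simp_all add: principal_unit_group_simps padic_of_int_principal_unit[OF p0])
    then have "?u \<in> principal_units p (q + r) #>\<^bsub>principal_unit_group p r\<^esub> ?v"
      using \<open>?L\<close> by (simp add: unit_coset_of_int)
    then obtain h where h: "h \<in> principal_units p (q + r)" "?u = h \<otimes>\<^bsub>padic_int p\<^esub> ?v"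
      by (auto simp: r_coset_def principal_unit_group_simps)
    \<comment> \<open>At level \<open>q + r\<close> the factor \<open>h\<close> is invisible, so
      this residue suffices to compare \<open>?u\<close> with \<open>?v\<close>.\<close>
    have "h (q + r) = 1 mod p ^ (q + r)"
      using h(1) by (auto simp: principal_units_iff)
    then have "?u (q + r) = ?v (q + r)"
      using h(2) by (simp add: padic_int_simps padic_of_int_def mod_mult_eq)
    then have "p ^ (q + r) dvd p ^ r * (a * b) - p ^ r * (c * d)"
      by (simp add: padic_of_int_def mod_eq_dvd_iff)
    then have "p ^ r * p ^ q dvd p ^ r * (a * b - c * d)"
      by (simp add: power_add algebra_simps)
    then show ?thesis
      using p0 by (simp add: cong_iff_dvd_diff)
  qed
qed

lemma unit_coset_of_int_in_carrier:
  assumes "p > 0"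
  shows "unit_coset p r q (padic_of_int p a) (padic_of_int p b) \<in>
    carrier (principal_unit_quotient p r q)"
  unfolding unit_coset_of_int principal_unit_quotient_def FactGroup_def RCOSETS_def
  using padic_of_int_principal_unit[OF assms, of r "a * b"]
  by (auto simp: principal_unit_group_simps)

text \<open>Expanding (1 + es)(1 + et) = 1 + e(s + t + est) with e = \<open>p ^ r\<close> keeps the
  product among the units reached by \<open>unit_coset\<close>. The second argument 1 only serves to
  write it in that form.\<close>

lemma unit_coset_of_int_mult:
  assumes p: "p > 1" and r: "r \<ge> 1"
  shows "unit_coset p r q (padic_of_int p a) (padic_of_int p b)
      \<otimes>\<^bsub>principal_unit_quotient p r q\<^esub> unit_coset p r q (padic_of_int p c) (padic_of_int p d) =
    unit_coset p r q (padic_of_int p (a * b + c * d + p ^ r * (a * b) * (c * d))) (padic_of_int p 1)"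
proof -
  have p0: "p > 0" using p by simp
  interpret G: comm_group "principal_unit_group p r"
    by (rule comm_group_principal_unit_group[OF p r])
  interpret N: normal "principal_units p (q + r)" "principal_unit_group p r"
    by (rule G.subgroup_imp_normal[OF principal_units_subgroup[OF p r]]) simp
  have "(1 + p ^ r * (a * b)) * (1 + p ^ r * (c * d)) =
      1 + p ^ r * (a * b + c * d + p ^ r * (a * b) * (c * d))"
    by (simp add: algebra_simps)
  then show ?thesis
    using N.rcos_sum[of "padic_of_int p (1 + p ^ r * (a * b))" "padic_of_int p (1 + p ^ r * (c * d))"]
      padic_of_int_principal_unit[OF p0]
    by (simp add: unit_coset_of_int principal_unit_quotient_def FactGroup_def
        principal_unit_group_simps padic_of_int_mult)
qed

text \<open>Injectivity of the character gives the first claim and multiplicativity the second. The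
  arguments range over all integers, so sums and products can be used without reducing them modulo
  \<open>p ^ q\<close>.\<close>

lemma
  assumes "p > 1" "r \<ge> 1" "faithful_character (principal_unit_quotient p r q) \<chi>"
  shows psi_eq_iff: "psi p r q \<chi> a b = psi p r q \<chi> c d \<longleftrightarrow> [a * b = c * d] (mod p ^ q)"
    and psi_mult: "psi p r q \<chi> a b * psi p r q \<chi> c d =
      psi p r q \<chi> (a * b + c * d + p ^ r * (a * b) * (c * d)) 1"
    and psi_nonzero: "psi p r q \<chi> a b \<noteq> 0"
proof -
  have hom: "\<chi> \<in> hom (principal_unit_quotient p r q) complex_units"
    and inj: "inj_on \<chi> (carrier (principal_unit_quotient p r q))"
    using assms(3) by (auto simp: faithful_character_def)
  have carr: "unit_coset p r q (padic_of_int p a) (padic_of_int p b) \<in>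
      carrier (principal_unit_quotient p r q)" for a b
    using assms(1) by (intro unit_coset_of_int_in_carrier) simp
  show "psi p r q \<chi> a b = psi p r q \<chi> c d \<longleftrightarrow> [a * b = c * d] (mod p ^ q)"
    unfolding psi_def inj_on_eq_iff[OF inj carr carr]
    by (rule unit_coset_of_int_eq_iff[OF assms(1,2)])
  show "psi p r q \<chi> a b * psi p r q \<chi> c d =
      psi p r q \<chi> (a * b + c * d + p ^ r * (a * b) * (c * d)) 1"
    unfolding psi_def unit_coset_of_int_mult[OF assms(1,2), symmetric]
    using hom_mult[OF hom carr carr] by (simp add: complex_units_def)
  show "psi p r q \<chi> a b \<noteq> 0"
    using hom_carrier[OF hom] carr[of a b] by (auto simp: psi_def complex_units_def)
qed

lemma psi_zero:
  assumes "p > 1" "r \<ge> 1" "faithful_character (principal_unit_quotient p r q) \<chi>"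
  shows "psi p r q \<chi> a 0 = 1" "psi p r q \<chi> 0 a = 1"
proof -
  \<comment> \<open>A nonzero complex number equal to its own square is 1.\<close>
  have "psi p r q \<chi> 0 1 * psi p r q \<chi> 0 1 = psi p r q \<chi> 0 1"
    using psi_mult[OF assms, of 0 1 0 1] by simp
  then have "psi p r q \<chi> 0 1 = 1"
    using psi_nonzero[OF assms, of 0 1] by simp
  then show "psi p r q \<chi> a 0 = 1" "psi p r q \<chi> 0 a = 1"
    using psi_eq_iff[OF assms, of a 0 0 1] psi_eq_iff[OF assms, of 0 a 0 1] by simp_all
qed

text \<open>\<open>psi_mult\<close> turns each side into a single value of \<open>psi\<close>. The
  linear parts of the two first arguments are both ab + ac + bc, and the quadratic parts differ by
  \<open>p ^ r\<close> times ab(a + b)c - a(b + c)bc = abc(a - c).\<close>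

lemma psi_cocycle_iff:
  assumes "p > 1" "r \<ge> 1" "faithful_character (principal_unit_quotient p r q) \<chi>"
  shows "psi p r q \<chi> a b * psi p r q \<chi> ((a + b) mod p ^ q) c =
      psi p r q \<chi> a ((b + c) mod p ^ q) * psi p r q \<chi> b c \<longleftrightarrow>
    [p ^ r * a * b * c * (a - c) = 0] (mod p ^ q)"
proof -
  have red: "psi p r q \<chi> ((a + b) mod p ^ q) c = psi p r q \<chi> (a + b) c"
    "psi p r q \<chi> a ((b + c) mod p ^ q) = psi p r q \<chi> a (b + c)"
    unfolding psi_eq_iff[OF assms] by (simp_all add: cong_def mod_simps)
  show ?thesis
    unfolding red psi_mult[OF assms] psi_eq_iff[OF assms]
    by (simp add: cong_iff_dvd_diff algebra_simps)
qed

lemma (in abelian_monoid) is_2cocycle_mult_coboundary_iff: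
  assumes f: "normalized_1cochain G f"
  shows "is_2cocycle G (\<lambda>a b. \<psi> a b * coboundary G f a b) \<longleftrightarrow> is_2cocycle G \<psi>"
proof -
  have nz: "f a \<noteq> 0" if "a \<in> carrier G" for a
    using f that by (auto simp: normalized_1cochain_def complex_units_def Pi_iff)
  have "(\<psi> a b * coboundary G f a b) * (\<psi> (a \<oplus> b) c * coboundary G f (a \<oplus> b) c) =
      (\<psi> a (b \<oplus> c) * coboundary G f a (b \<oplus> c)) * (\<psi> b c * coboundary G f b c) \<longleftrightarrow>
    \<psi> a b * \<psi> (a \<oplus> b) c = \<psi> a (b \<oplus> c) * \<psi> b c"
    if abc: "a \<in> carrier G" "b \<in> carrier G" "c \<in> carrier G" for a b c
  proof -
    \<comment> \<open>The values of \<open>f\<close> at the two partial sums cancel, so both sides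
      of the cocycle identity acquire this same nonzero factor.\<close>
    let ?k = "f a * f b * f c / f (a \<oplus> b \<oplus> c)"
    have "coboundary G f a b * coboundary G f (a \<oplus> b) c = ?k"
      "coboundary G f a (b \<oplus> c) * coboundary G f b c = ?k"
      using abc nz by (simp_all add: coboundary_def a_assoc)
    then have "(\<psi> a b * coboundary G f a b) * (\<psi> (a \<oplus> b) c * coboundary G f (a \<oplus> b) c) =
        (\<psi> a b * \<psi> (a \<oplus> b) c) * ?k"
      "(\<psi> a (b \<oplus> c) * coboundary G f a (b \<oplus> c)) * (\<psi> b c * coboundary G f b c) =
        (\<psi> a (b \<oplus> c) * \<psi> b c) * ?k"
      by (metis mult.assoc mult.left_commute)+
    moreover have "?k \<noteq> 0" using abc nz by simp
    ultimately show ?thesis by simp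
  qed
  then show ?thesis by (simp add: is_2cocycle_def)
qed

lemma (in ring) is_2cocycle_unit_scaleD:
  assumes u: "u \<in> Units R" and cocycle: "is_2cocycle R (\<lambda>a b. \<psi> (u \<otimes> a) (u \<otimes> b))"
  shows "is_2cocycle R \<psi>"
  unfolding is_2cocycle_def
proof (intro ballI)
  fix a b c assume abc: "a \<in> carrier R" "b \<in> carrier R" "c \<in> carrier R"
  have uc: "u \<in> carrier R" using u by (rule Units_closed)
  have closed: "inv u \<otimes> x \<in> carrier R" and cancel: "u \<otimes> (inv u \<otimes> x) = x"
    if "x \<in> carrier R" for x
    using that u uc m_assoc[of u "inv u" x] by simp_all
  \<comment> \<open>The rescaled identity is evaluated at the preimages of \<open>a\<close>,
    \<open>b\<close>, \<open>c\<close> under multiplication by \<open>u\<close>; distributivity then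
    carries \<open>u\<close> through the sums.\<close>
  have "\<psi> (u \<otimes> (inv u \<otimes> a)) (u \<otimes> (inv u \<otimes> b)) *
        \<psi> (u \<otimes> (inv u \<otimes> a \<oplus> inv u \<otimes> b)) (u \<otimes> (inv u \<otimes> c)) =
      \<psi> (u \<otimes> (inv u \<otimes> a)) (u \<otimes> (inv u \<otimes> b \<oplus> inv u \<otimes> c)) *
        \<psi> (u \<otimes> (inv u \<otimes> b)) (u \<otimes> (inv u \<otimes> c))"
    using cocycle closed[OF abc(1)] closed[OF abc(2)] closed[OF abc(3)]
    unfolding is_2cocycle_def by blast
  then show "\<psi> a b * \<psi> (a \<oplus> b) c = \<psi> a (b \<oplus> c) * \<psi> b c"
    by (simp only: r_distr[OF closed[OF abc(1)] closed[OF abc(2)] uc]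
        r_distr[OF closed[OF abc(2)] closed[OF abc(3)] uc] cancel abc)
qed

theorem theorem4p4:
  fixes p :: int and r q :: nat and \<chi> :: "(nat \<Rightarrow> int) set \<Rightarrow> complex"
  defines "R \<equiv> residue_ring (p ^ q)"
    and "\<psi> \<equiv> psi p r q \<chi>"
  assumes "prime p" and "odd p" and "r \<ge> 1" and "q \<ge> 1"
    and "faithful_character (principal_unit_quotient p r q) \<chi>"
  shows "normalized_2cochain R \<psi> \<and>
    (\<forall>a \<in> carrier R. \<forall>b \<in> carrier R. \<forall>c \<in> carrier R.
       associator R \<psi> a b c = 1 \<longleftrightarrow> [p ^ r * a * b * c * (a - c) = 0] (mod p ^ q)) \<and>
    (is_2cocycle R \<psi> \<longleftrightarrow> q \<le> r) \<and>
    (q > r \<longrightarrow>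
       (\<forall>f. normalized_1cochain R f \<longrightarrow>
          \<not> is_2cocycle R (\<lambda>a b. \<psi> a b * coboundary R f a b)) \<and>
       (\<forall>u \<in> Units R. \<not> is_2cocycle R (\<lambda>a b. \<psi> (u \<otimes>\<^bsub>R\<^esub> a) (u \<otimes>\<^bsub>R\<^esub> b))))"
proof -
  have p: "p > 1" using \<open>prime p\<close> by (rule prime_gt_1_int)
  note psi = p \<open>r \<ge> 1\<close> \<open>faithful_character (principal_unit_quotient p r q) \<chi>\<close>
  \<comment> \<open>The bound 3 on \<open>p ^ q\<close> ensures that 2 is itself a canonical
    residue, as needed for the triple (1, 1, 2).\<close>
  have "p \<ge> 3" using p \<open>odd p\<close> by (cases "p = 2") auto
  moreover have "p \<le> p ^ q" using p \<open>q \<ge> 1\<close> by (simp add: self_le_power)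
  ultimately have pq: "p ^ q \<ge> 3" by simp
  interpret residues "p ^ q" R
    using pq unfolding residues_def R_def by simp_all
  have add: "a \<oplus>\<^bsub>R\<^esub> b = (a + b) mod p ^ q" for a b
    by (rule res_add_eq)
  have nz: "\<psi> a b \<noteq> 0" for a b
    unfolding \<psi>_def by (rule psi_nonzero[OF psi])
  have cocycle: "\<psi> a b * \<psi> (a \<oplus>\<^bsub>R\<^esub> b) c = \<psi> a (b \<oplus>\<^bsub>R\<^esub> c) * \<psi> b c \<longleftrightarrow>
      [p ^ r * a * b * c * (a - c) = 0] (mod p ^ q)" for a b c
    unfolding add \<psi>_def by (rule psi_cocycle_iff[OF psi])
  have "normalized_2cochain R \<psi>"
    using nz psi_zero[OF psi]
    by (simp add: normalized_2cochain_def complex_units_def \<psi>_def res_zero_eq)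
  moreover have "associator R \<psi> a b c = 1 \<longleftrightarrow> [p ^ r * a * b * c * (a - c) = 0] (mod p ^ q)"
    for a b c
    using nz by (simp add: associator_def cocycle[symmetric])
  moreover have iff: "is_2cocycle R \<psi> \<longleftrightarrow> q \<le> r"
  proof
    assume "q \<le> r"
    \<comment> \<open>Here the factor \<open>p ^ r\<close> alone already vanishes modulo
      \<open>p ^ q\<close>.\<close>
    then have "p ^ q dvd p ^ r * a * b * c * (a - c)" for a b c
      by (simp add: le_imp_power_dvd)
    then show "is_2cocycle R \<psi>"
      by (simp add: is_2cocycle_def cocycle cong_0_iff)
  next
    assume "is_2cocycle R \<psi>"
    moreover have "1 \<in> carrier R" "2 \<in> carrier R"
      using pq by (simp_all add: res_carrier_eq)
    \<comment> \<open>At this triple abc(a - c) = -2 is prime to \<open>p\<close>, so the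
      obstruction reduces to comparing the powers \<open>p ^ q\<close> and
      \<open>p ^ r\<close>.\<close>
    ultimately have "[p ^ r * 1 * 1 * 2 * (1 - 2) = 0] (mod p ^ q)"
      unfolding is_2cocycle_def cocycle by blast
    then have "p ^ q dvd p ^ r * 2"
      by (simp add: cong_0_iff)
    moreover have "coprime (p ^ q) 2" using \<open>odd p\<close> by simp
    ultimately have "p ^ q dvd p ^ r"
      by (simp add: coprime_dvd_mult_left_iff)
    then show "q \<le> r"
      using p by (simp add: dvd_power_iff)
  qed
  moreover have "\<not> is_2cocycle R (\<lambda>a b. \<psi> a b * coboundary R f a b)"
    if "q > r" "normalized_1cochain R f" for f
    using that iff is_2cocycle_mult_coboundary_iff[of f \<psi>] by simp
  moreover have "\<not> is_2cocycle R (\<lambda>a b. \<psi> (u \<otimes>\<^bsub>R\<^esub> a) (u \<otimes>\<^bsub>R\<^esub> b))"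
    if "q > r" "u \<in> Units R" for u
    using that iff is_2cocycle_unit_scaleD[of u \<psi>] by auto
  ultimately show ?thesis by blast
qed

end
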